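(* Let $p$ be a prime, $0<\rho<1$, $c\in\mathbb{R}$, $M=\begin{bmatrix}\rho^{-1} & c\\ 0 & \rho^{-1}\end{bmatrix}$, and let $D=\{d_0,d_1,\dots,d_{p-1}\}\subset\mathbb{Z}^2$ be a set of $p$ distinct vectors such that $\mathcal{Z}(\widehat{\delta}_D)=\bigcup_{j=1}^{p-1}\left(\frac{j\bm{a}}{p}+\mathbb{Z}^2\right)$ for some $\bm{a}\in\mathcal{E}_p$. Let $\mu_{M,D}$ be the associated self-affine measure. Then $L^2(\mu_{M,D})$ admits an infinite orthogonal set of exponential functions if and only if $\rho^{-1}=\left(\frac{t}{s}\right)^{1/r}$ and $c=\kappa\rho^{-1}$ for some $s,t,r\in\mathbb{N}$ with $t\in p\mathbb{Z}$ and $\gcd(s,t)=1$, and some $\kappa\in\mathbb{Q}$.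
   Context: $\mathbb{N}=\{1,2,3,\dots\}$ here. $v^*$ denotes the (conjugate) transpose, so $(i_1,i_2)^*$ is a column vector. $\mathcal{E}_p=\{(i_1,i_2)^*: i_1,i_2\in\{1,\dots,p-1\}\}$. For a finite set $E\subset\mathbb{R}^2$, $\delta_E=\frac{1}{\#E}\sum_{e\in E}\delta_e$, where $\delta_e$ is the Dirac measure at $e$. For a compactly supported Borel probability measure $\mu$ on $\mathbb{R}^2$, $\widehat{\mu}(\xi)=\int e^{-2\pi i\langle\xi,x\rangle}\,d\mu(x)$, $\xi\in\mathbb{R}^2$; $\mathcal{Z}(f)$ is the set of zeros of $f$ in $\mathbb{R}^2$. The self-affine measure $\mu_{M,D}$ is the unique Borel probability measure satisfying $\mu=\frac{1}{\#D}\sum_{d\in D}\mu\circ\varphi_d^{-1}$ with $\varphi_d(x)=M^{-1}(x+d)$. Saying that $L^2(\mu)$ admits an infinite orthogonal set of exponential functions means there is an infinite $\Lambda\subset\mathbb{R}^2$ such that the functions $e^{-2\pi i\langle\lambda,x\rangle}$, $\lambda\in\Lambda$, are pairwise orthogonal in $L^2(\mu)$. *)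

theory Defs
  imports "HOL-Analysis.Analysis" "HOL-Probability.Probability"
begin

definition integer_lattice :: "(real^2) set" where
  "integer_lattice = {x. \<forall>i. x $ i \<in> \<int>}"

definition E_set :: "nat \<Rightarrow> (real^2) set" where
  "E_set p = {vector [real i1, real i2] | i1 i2. i1 \<in> {1..p - 1} \<and> i2 \<in> {1..p - 1}}"

text \<open>The average (1 / #E) * sum of \<nu> e over e in E, as a Borel measure; it is meant for
  a finite nonempty E and Borel measures \<nu> e.\<close>

definition avg_measure :: "(real^2) set \<Rightarrow> (real^2 \<Rightarrow> (real^2) measure) \<Rightarrow> (real^2) measure" where
  "avg_measure E \<nu> =
     measure_of UNIV (sets borel) (\<lambda>A. (\<Sum>e\<in>E. emeasure (\<nu> e) A) / of_nat (card E))"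

lemma sets_avg_measure [simp, measurable_cong]: "sets (avg_measure E \<nu>) = sets borel"
  unfolding avg_measure_def
  by (metis sets.sets_measure_of_eq space_borel)

lemma space_avg_measure [simp]: "space (avg_measure E \<nu>) = UNIV"
  by (simp add: avg_measure_def space_measure_of_conv)

lemma emeasure_avg_measure:
  assumes "\<And>e. e \<in> E \<Longrightarrow> sets (\<nu> e) = sets borel" and "A \<in> sets borel"
  shows "emeasure (avg_measure E \<nu>) A = (\<Sum>e\<in>E. emeasure (\<nu> e) A) / of_nat (card E)"
proof (rule emeasure_measure_of[OF avg_measure_def])
  show "countably_additive (sets (avg_measure E \<nu>))
          (\<lambda>A. (\<Sum>e\<in>E. emeasure (\<nu> e) A) / of_nat (card E))"
  proof (rule countably_additiveI)
    fix B :: "nat \<Rightarrow> (real^2) set"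
    assume B: "range B \<subseteq> sets (avg_measure E \<nu>)" "disjoint_family B"
    have "(\<Sum>i. emeasure (\<nu> e) (B i)) = emeasure (\<nu> e) (\<Union>i. B i)" if "e \<in> E" for e
      using B assms(1)[OF that] by (intro suminf_emeasure) auto
    then show "(\<Sum>i. (\<Sum>e\<in>E. emeasure (\<nu> e) (B i)) / of_nat (card E)) =
        (\<Sum>e\<in>E. emeasure (\<nu> e) (\<Union>i. B i)) / of_nat (card E)"
      by (simp add: suminf_sum divide_ennreal_def)
  qed
qed (use assms in \<open>auto simp: positive_def\<close>)

definition delta_measure :: "(real^2) set \<Rightarrow> (real^2) measure" where
  "delta_measure E = avg_measure E (\<lambda>e. return borel e)"

definition expo :: "real^2 \<Rightarrow> real^2 \<Rightarrow> complex" where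
  "expo \<xi> x = exp (- 2 * of_real pi * \<i> * of_real (\<xi> \<bullet> x))"

definition fourier :: "(real^2) measure \<Rightarrow> real^2 \<Rightarrow> complex" where
  "fourier \<mu> \<xi> = (LINT x|\<mu>. expo \<xi> x)"

definition zero_set :: "(real^2 \<Rightarrow> complex) \<Rightarrow> (real^2) set" where
  "zero_set f = {\<xi>. f \<xi> = 0}"

definition affine_map :: "real^2^2 \<Rightarrow> real^2 \<Rightarrow> real^2 \<Rightarrow> real^2" where
  "affine_map M d x = matrix_inv M *v (x + d)"

text \<open>For expanding M and finite nonempty D there is exactly one such \<mu> (Hutchinson), the
  self-affine measure of M and D. The average is a Borel measure, so the equation also fixes
  the sigma-algebra of \<mu>.\<close>

definition is_self_affine_measure :: "real^2^2 \<Rightarrow> (real^2) set \<Rightarrow> (real^2) measure \<Rightarrow> bool" where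
  "is_self_affine_measure M D \<mu> \<longleftrightarrow>
     prob_space \<mu> \<and> \<mu> = avg_measure D (\<lambda>d. distr \<mu> borel (affine_map M d))"

definition L2_inner :: "(real^2) measure \<Rightarrow> (real^2 \<Rightarrow> complex) \<Rightarrow> (real^2 \<Rightarrow> complex) \<Rightarrow> complex" where
  "L2_inner \<mu> f g = (LINT x|\<mu>. f x * cnj (g x))"

definition admits_infinite_orthogonal_exponentials :: "(real^2) measure \<Rightarrow> bool" where
  "admits_infinite_orthogonal_exponentials \<mu> \<longleftrightarrow>
     (\<exists>\<Lambda>. infinite \<Lambda> \<and> pairwise (\<lambda>x y. L2_inner \<mu> (expo x) (expo y) = 0) \<Lambda>)"

end

theory Submission
  imports Defs "HOL-Computational_Algebra.Polynomial_Factorial" "HOL-Library.Ramsey"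
    "HOL-Number_Theory.Cong"
begin

text \<open>Write \<open>l = inverse \<rho>\<close> and \<open>\<kappa> = c * \<rho>\<close>, so that \<open>c = \<kappa> * inverse \<rho>\<close> and the \<open>k\<close>-th power of the
transpose of \<open>M\<close> maps \<open>(x, y)\<close> to \<open>l ^ k * (x, y + k * \<kappa> * x)\<close>. Two exponentials are orthogonal
exactly when the difference of their frequencies is a zero of the Fourier transform of the
self-affine measure, and these zeros are the images of the zeros of the digit set under the powers
with \<open>k \<ge> 1\<close> (lemma \<open>fourier_self_affine_eq_0_iff\<close>). The zeros of the digit set are the vectors
\<open>j a / p\<close> plus an integer vector, with \<open>j\<close> prime to \<open>p\<close>. So the theorem is a question about
infinite sets in the plane whose differences all lie in the union of these images.

If \<open>l ^ r = t / s\<close> with \<open>p\<close> dividing \<open>t\<close> only, and \<open>\<kappa>\<close> is rational, some power of the transpose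
is \<open>T / S\<close> times an integral matrix, and the images under its powers of \<open>a / p\<close>, multiplied by
matching powers of \<open>S\<close>, form such a set (lemma \<open>rational_data_imp_infinite_orthogonal\<close>).

Conversely, the first coordinates of the differences, multiplied by \<open>p\<close>, have the form \<open>u * l ^ k\<close>
with an integer \<open>u\<close> prime to \<open>p\<close>. Three points give a trinomial equation for \<open>l\<close> all of whose
coefficients are prime to \<open>p\<close>. If \<open>v\<close> extends the \<open>p\<close>-adic valuation to \<open>l\<close>, the differences have
valuation \<open>k * v l\<close>. The case \<open>v l = 0\<close> is impossible, as infinitely many points would be pairwise
incongruent in a finite residue ring (lemma \<open>p_unit_root_no_infinite_difference_set\<close>). If
\<open>v l < 0\<close>, the exponents form an ultrametric, which the ordinary absolute value together with
\<open>l > 1\<close> forces to be bounded, so infinitely many points have equal exponents; this is impossible,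
because their integer factors would be pairwise incongruent modulo \<open>p\<close>. If \<open>v l > 0\<close>, then the two
smallest exponents of every triple agree. The exponents cannot all be equal, and a triple with a
larger third exponent shows that a power of \<open>l\<close> is a fraction with numerator divisible by \<open>p\<close>. The proof of lemma
\<open>difference_set_yields_p_divisible_power\<close> carries this out without valuations on extension fields,
by arguing with integer polynomials directly. The second coordinates of the same triple give a
linear equation that determines \<open>\<kappa>\<close> as a rational number.\<close>

section \<open>Integer polynomials at a real number, modulo a prime\<close>

definition eval_int_poly :: "real \<Rightarrow> int poly \<Rightarrow> real" where
  "eval_int_poly x f = poly (map_poly of_int f) x"

lemma eval_int_poly_0 [simp]: "eval_int_poly x 0 = 0"
  by (simp add: eval_int_poly_def)

lemma eval_int_poly_pCons [simp]:
  "eval_int_poly x (pCons a f) = of_int a + x * eval_int_poly x f"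
  by (simp add: eval_int_poly_def map_poly_pCons)

lemma eval_int_poly_add [simp]:
  "eval_int_poly x (f + g) = eval_int_poly x f + eval_int_poly x g"
  by (induction f g rule: poly_induct2) (simp_all add: algebra_simps)

lemma eval_int_poly_smult [simp]:
  "eval_int_poly x (smult a f) = of_int a * eval_int_poly x f"
  by (induction f) (simp_all add: algebra_simps)

lemma eval_int_poly_minus [simp]: "eval_int_poly x (- f) = - eval_int_poly x f"
  by (induction f) (simp_all add: algebra_simps)

lemma eval_int_poly_diff [simp]:
  "eval_int_poly x (f - g) = eval_int_poly x f - eval_int_poly x g"
  using eval_int_poly_add[of x f "- g"] by simp

lemma eval_int_poly_mult [simp]:
  "eval_int_poly x (f * g) = eval_int_poly x f * eval_int_poly x g"
  by (induction f) (simp_all add: algebra_simps)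

lemma eval_int_poly_monom [simp]: "eval_int_poly x (monom a n) = of_int a * x ^ n"
  by (induction n) (simp_all add: monom_0 monom_Suc)

lemma primitive_dvd_smult_int:
  fixes h f :: "int poly"
  assumes "content h = 1" "a \<noteq> 0" "h dvd smult a f"
  shows "h dvd f"
proof -
  obtain q where q: "smult a f = h * q" using assms(3) by (auto elim: dvdE)
  have "content q = content (smult a f)" by (simp add: q content_mult assms(1))
  then have "a dvd content q" by simp
  then have "[:a:] dvd q" by (simp add: const_poly_dvd_iff_dvd_content)
  then obtain q' where "q = smult a q'" by (auto elim!: dvdE)
  then have "smult a f = smult a (h * q')" using q by simp
  then have "f = h * q'" using assms(2) by (metis smult_cancel)
  then show ?thesis by simp
qed

text \<open>An integer polynomial of least degree that vanishes at \<open>x\<close>, divided by its content,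
divides every other one already over the integers: pseudo-division gives divisibility of a
multiple, and the content of a product is the product of the contents. Divisibility over the
integers is what allows reduction modulo \<open>p\<close> afterwards.\<close>

lemma primitive_generator_exists:
  assumes "f \<noteq> 0" "eval_int_poly x f = 0"
  obtains h where "degree h > 0"
    "\<And>g. eval_int_poly x g = 0 \<Longrightarrow> h dvd g"
proof -
  define P where "P = (\<lambda>g. g \<noteq> 0 \<and> eval_int_poly x g = 0)"
  define m where "m = arg_min degree P"
  have "P f" using assms by (simp add: P_def)
  then have m: "P m" and min: "\<And>g. P g \<Longrightarrow> degree m \<le> degree g"
    unfolding m_def by (auto intro: arg_min_natI arg_min_nat_le)
  have m0: "m \<noteq> 0" using m by (simp add: P_def)
  define h where "h = primitive_part m"
  have mh: "m = smult (content m) h" by (simp add: h_def)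
  have c: "content h = 1" using m0 by (simp add: h_def)
  have h0: "h \<noteq> 0" using c by auto
  have dh: "degree h = degree m" using m0 by (simp add: h_def)
  have xh: "eval_int_poly x h = 0"
  proof -
    have "of_int (content m) * eval_int_poly x h = 0"
      using m mh eval_int_poly_smult P_def by metis
    then show ?thesis using m0 by simp
  qed
  have div: "h dvd g" if g: "eval_int_poly x g = 0" for g
  proof -
    obtain a q where aq: "a \<noteq> 0" "smult a g = h * q + pseudo_mod g h"
      using pseudo_mod(1)[OF h0, of g] by blast
    have "eval_int_poly x (smult a g) = eval_int_poly x (h * q + pseudo_mod g h)"
      using aq(2) by simp
    then have r: "eval_int_poly x (pseudo_mod g h) = 0" using g xh by simp
    have "pseudo_mod g h = 0"
    proof (rule ccontr)
      assume n: "pseudo_mod g h \<noteq> 0"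
      then have "P (pseudo_mod g h)" using r by (simp add: P_def)
      then have "degree m \<le> degree (pseudo_mod g h)" by (rule min)
      moreover have "degree (pseudo_mod g h) < degree h"
        using pseudo_mod(2)[OF h0, of g] n by auto
      ultimately show False using dh by simp
    qed
    then have "h dvd smult a g" using aq by simp
    then show ?thesis using primitive_dvd_smult_int c aq(1) by blast
  qed
  have "degree h > 0"
  proof (rule ccontr)
    assume "\<not> degree h > 0"
    then obtain b where "h = [:b:]" by (auto elim: degree_eq_zeroE)
    then show False using xh h0 by simp
  qed
  then show ?thesis using div that by blast
qed

text \<open>This replaces the extension of the \<open>p\<close>-adic valuation to the field generated by \<open>x\<close>: the Newton
polygon of \<open>f\<close> is flat, so \<open>x\<close> should be a \<open>p\<close>-adic unit and \<open>u x^l\<close> cannot be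
divisible by \<open>p\<close>. Concretely, \<open>f\<close> and \<open>u X^l - p h\<close> would have a common factor of positive
degree whose two end coefficients survive modulo \<open>p\<close>, but a monomial modulo \<open>p\<close> has no such
factor.\<close>

lemma no_common_root_of_unit_ends_and_monomial:
  fixes p :: int and f h :: "int poly"
  assumes p: "prime p" and lead: "\<not> p dvd lead_coeff f" and const: "\<not> p dvd coeff f 0"
    and f: "eval_int_poly x f = 0" and u: "\<not> p dvd u"
  shows "of_int u * x ^ l \<noteq> of_int p * eval_int_poly x h"
proof
  assume eq: "of_int u * x ^ l = of_int p * eval_int_poly x h"
  define g where "g = monom u l - smult p h"
  have g: "eval_int_poly x g = 0" using eq by (simp add: g_def)
  have "f \<noteq> 0" using lead by auto
  then obtain k where k: "degree k > 0" "\<And>g. eval_int_poly x g = 0 \<Longrightarrow> k dvd g"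
    using primitive_generator_exists f by blast
  obtain q where q: "f = k * q" using k(2)[OF f] by (auto elim: dvdE)
  obtain r where r: "g = k * r" using k(2)[OF g] by (auto elim: dvdE)
  have lk: "\<not> p dvd lead_coeff k" using lead by (auto simp: q lead_coeff_mult)
  have ck: "\<not> p dvd coeff k 0" using const by (auto simp: q coeff_mult)
  define J where "J = {i. \<not> p dvd coeff r i}"
  have "J \<subseteq> {..degree r}"
    by (auto simp: J_def intro: le_degree ccontr)
  then have fin: "finite J" using finite_subset by blast
  have gc: "p dvd coeff g i \<longleftrightarrow> i \<noteq> l" for i
    using u by (simp add: g_def coeff_diff dvd_diff_left_iff)
  have "J \<noteq> {}"
  proof
    assume "J = {}"
    then have "p dvd coeff g l" unfolding r coeff_mult J_def by (auto intro: dvd_sum)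
    then show False using gc by simp
  qed
  \<comment> \<open>The lowest and the highest coefficient of r that survive modulo p are multiplied by the
    surviving end coefficients of k and so produce two surviving coefficients of g.\<close>
  define i where "i = Min J"
  define j where "j = Max J"
  have i: "i \<in> J" "\<And>n. n \<in> J \<Longrightarrow> i \<le> n" and j: "j \<in> J" "\<And>n. n \<in> J \<Longrightarrow> n \<le> j"
    using fin \<open>J \<noteq> {}\<close> by (auto simp: i_def j_def)
  have "\<not> p dvd coeff g i"
  proof -
    have "coeff g i = coeff k 0 * coeff r i + (\<Sum>n\<in>{..i}-{0}. coeff k n * coeff r (i - n))"
      unfolding r coeff_mult by (subst sum.remove[of _ 0]) auto
    moreover have "p dvd (\<Sum>n\<in>{..i}-{0}. coeff k n * coeff r (i - n))"
    proof (rule dvd_sum)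
      fix n assume "n \<in> {..i}-{0}"
      then have "i - n < i" by auto
      then have "i - n \<notin> J" using i(2) by (meson not_le)
      then show "p dvd coeff k n * coeff r (i - n)" by (simp add: J_def)
    qed
    moreover have "\<not> p dvd coeff k 0 * coeff r i"
      using ck i(1) p by (simp add: J_def prime_dvd_mult_iff)
    ultimately show ?thesis by (simp add: dvd_add_left_iff)
  qed
  moreover have "\<not> p dvd coeff g (degree k + j)"
  proof -
    have "coeff g (degree k + j) = lead_coeff k * coeff r j +
        (\<Sum>n\<in>{..degree k + j}-{degree k}. coeff k n * coeff r (degree k + j - n))"
      unfolding r coeff_mult by (subst sum.remove[of _ "degree k"]) auto
    moreover have "p dvd (\<Sum>n\<in>{..degree k + j}-{degree k}. coeff k n * coeff r (degree k + j - n))"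
    proof (rule dvd_sum)
      fix n assume n: "n \<in> {..degree k + j}-{degree k}"
      show "p dvd coeff k n * coeff r (degree k + j - n)"
      proof (cases "n < degree k")
        case True
        then have "degree k + j - n > j" by auto
        then have "degree k + j - n \<notin> J" using j(2) by (meson not_le)
        then show ?thesis by (simp add: J_def)
      next
        case False
        then show ?thesis using n by (simp add: coeff_eq_0)
      qed
    qed
    moreover have "\<not> p dvd lead_coeff k * coeff r j"
      using lk j(1) p by (simp add: J_def prime_dvd_mult_iff)
    ultimately show ?thesis by (simp add: dvd_add_left_iff)
  qed
  ultimately have "i = l" "degree k + j = l" using gc by auto
  then show False using k(1) i(2)[OF j(1)] by simp
qed

text \<open>Reduction modulo \<open>p\<close> turns \<open>f\<close> into a polynomial with invertible leading coefficient, so the ring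
generated by \<open>x\<close> over the integers has only finitely many residue classes modulo \<open>p\<close>; \<open>F\<close> lists
representatives.\<close>

lemma finite_residues_of_int_polys:
  fixes p :: int
  assumes p: "prime p" and lead: "\<not> p dvd lead_coeff f" and f: "eval_int_poly x f = 0"
  obtains F where "finite F"
    "\<And>q. \<exists>r\<in>F. \<exists>h. eval_int_poly x q = eval_int_poly x r + of_int p * eval_int_poly x h"
proof -
  define n where "n = degree f"
  have "coprime p (lead_coeff f)" using p lead by (simp add: prime_imp_coprime)
  then obtain b where "[lead_coeff f * b = 1] (mod p)"
    by (metis cong_solve_coprime_int coprime_commute)
  then obtain m where m: "lead_coeff f * b = 1 + p * m"
    by (metis cong_iff_lin cong_sym)
  define F where "F = Poly ` {xs. set xs \<subseteq> {0..<p} \<and> length xs \<le> n}"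
  have "finite F" unfolding F_def by (intro finite_imageI finite_lists_length_le) auto
  moreover have "\<exists>r\<in>F. \<exists>h. eval_int_poly x q = eval_int_poly x r + of_int p * eval_int_poly x h" for q
  proof -
    \<comment> \<open>A monic polynomial that is a multiple of f modulo p.\<close>
    define g where "g = smult b f - monom (p * m) n"
    have cn: "coeff g n = 1" using m by (simp add: g_def n_def mult.commute)
    have dg: "degree g = n"
    proof (rule antisym)
      show "degree g \<le> n" unfolding g_def
        by (intro degree_diff_le) (auto simp: n_def degree_monom_le degree_smult_le)
      show "n \<le> degree g" using cn by (intro le_degree) auto
    qed
    have g0: "g \<noteq> 0" using cn by auto
    obtain d r where dr: "pseudo_divmod q g = (d, r)" by force
    have q: "q = g * d + r" using pseudo_divmod(1)[OF g0 dr] dg cn by simp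
    have r: "r = 0 \<or> degree r < n" using pseudo_divmod(2)[OF g0 dr] dg by auto
    define r1 where "r1 = map_poly (\<lambda>c. c mod p) r"
    define r2 where "r2 = map_poly (\<lambda>c. c div p) r"
    have rr: "r = r1 + smult p r2"
      by (rule poly_eqI) (simp add: r1_def r2_def coeff_map_poly)
    have "length (coeffs r) \<le> n" using r by (cases "r = 0") (auto simp: length_coeffs_degree)
    moreover have "r1 = Poly (map (\<lambda>c. c mod p) (coeffs r))"
      by (simp add: r1_def map_poly_def)
    moreover have "set (map (\<lambda>c. c mod p) (coeffs r)) \<subseteq> {0..<p}"
      using p by (auto simp: prime_gt_0_int)
    ultimately have "r1 \<in> F" unfolding F_def by auto
    moreover have "eval_int_poly x q =
        eval_int_poly x r1 + of_int p * eval_int_poly x (r2 - smult m (monom 1 n * d))"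
      unfolding q by (subst rr) (simp add: g_def f algebra_simps)
    ultimately show ?thesis by blast
  qed
  ultimately show ?thesis using that by blast
qed

text \<open>For algebraic \<open>x\<close> this says that every extension of the \<open>p\<close>-adic valuation takes the value zero
at \<open>x\<close>.\<close>

definition p_unit_root :: "int \<Rightarrow> real \<Rightarrow> bool" where
  "p_unit_root p x \<longleftrightarrow>
     (\<exists>f. eval_int_poly x f = 0 \<and> \<not> p dvd lead_coeff f \<and> \<not> p dvd coeff f 0)"

text \<open>If \<open>x\<close> is a \<open>p\<close>-adic unit, then so is every difference \<open>g a - g b\<close>; hence the elements \<open>g a\<close>
are pairwise incongruent modulo \<open>p\<close>, and there are only finitely many residue classes.\<close>

lemma p_unit_root_no_infinite_difference_set:
  fixes p :: int and g :: "'a \<Rightarrow> real"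
  assumes p: "prime p" and unit: "p_unit_root p x" and inf: "infinite S"
    and diff: "\<And>a b. a \<in> S \<Longrightarrow> b \<in> S \<Longrightarrow> a \<noteq> b \<Longrightarrow>
      \<exists>(k::nat) u. \<not> p dvd u \<and> g a - g b = of_int u * x ^ k"
  shows False
proof -
  obtain f where f: "eval_int_poly x f = 0" "\<not> p dvd lead_coeff f" "\<not> p dvd coeff f 0"
    using unit by (auto simp: p_unit_root_def)
  obtain F where F: "finite F"
    "\<And>q. \<exists>r\<in>F. \<exists>h. eval_int_poly x q = eval_int_poly x r + of_int p * eval_int_poly x h"
    using finite_residues_of_int_polys[OF p f(2,1)] by blast
  obtain a0 where a0: "a0 \<in> S" using inf by fastforce
  have "\<exists>r\<in>F. \<exists>h. g a - g a0 = eval_int_poly x r + of_int p * eval_int_poly x h"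
    if aS: "a \<in> S" for a
  proof -
    have "\<exists>q. g a - g a0 = eval_int_poly x q"
    proof (cases "a = a0")
      case True
      then show ?thesis by (intro exI[of _ 0]) simp
    next
      case False
      then obtain k u where "g a - g a0 = of_int u * x ^ k" using diff[OF aS a0] by blast
      then show ?thesis by (intro exI[of _ "monom u k"]) simp
    qed
    then show ?thesis using F(2) by metis
  qed
  then obtain R H where R: "\<And>a. a \<in> S \<Longrightarrow> R a \<in> F"
    "\<And>a. a \<in> S \<Longrightarrow> g a - g a0 = eval_int_poly x (R a) + of_int p * eval_int_poly x (H a)"
    by metis
  have "\<not> inj_on R S"
    using R(1) F(1) inf by (meson finite_imageD finite_subset image_subsetI)
  then obtain a b where ab: "a \<in> S" "b \<in> S" "a \<noteq> b" "R a = R b" by (auto simp: inj_on_def)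
  obtain k u where ku: "\<not> p dvd u" "g a - g b = of_int u * x ^ k" using diff[OF ab(1-3)] by blast
  have "g a - g b = of_int p * eval_int_poly x (H a - H b)"
    using R(2)[OF ab(1)] R(2)[OF ab(2)] ab(4) by (simp add: algebra_simps)
  then show False
    using no_common_root_of_unit_ends_and_monomial[OF p f(2,3,1) ku(1)] ku(2) by metis
qed

section \<open>Infinite sets of reals whose differences are integers prime to p times powers of x\<close>

lemma p_unit_root_of_binomial:
  assumes "\<not> p dvd u" "\<not> p dvd v" "e > 0" "of_int u * x ^ e = of_int v"
  shows "p_unit_root p x"
proof -
  define f where "f = monom u e - [:v:]"
  have "u \<noteq> 0" using assms(1) by auto
  have ce: "coeff f e = u" using assms(3) by (simp add: f_def coeff_pCons split: nat.splits)
  have "degree f = e"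
  proof (rule antisym)
    show "degree f \<le> e" unfolding f_def by (intro degree_diff_le) (auto simp: degree_monom_le)
    show "e \<le> degree f" using ce \<open>u \<noteq> 0\<close> by (intro le_degree) auto
  qed
  moreover have "coeff f 0 = - v" using assms(3) by (simp add: f_def)
  moreover have "eval_int_poly x f = 0" using assms(4) by (simp add: f_def)
  ultimately show ?thesis unfolding p_unit_root_def using ce assms(1,2) by (intro exI[of _ f]) auto
qed

lemma p_unit_root_of_trinomial:
  assumes "\<not> p dvd u" "\<not> p dvd v" "\<not> p dvd w" "i < j" "j < k" "x \<noteq> 0"
    and "of_int u * x ^ i + of_int v * x ^ j = of_int w * x ^ k"
  shows "p_unit_root p x"
proof -
  define f where "f = [:u:] + monom v (j - i) - monom w (k - i)"
  have "w \<noteq> 0" using assms(3) by auto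
  have ce: "coeff f (k - i) = - w"
    using assms(4,5) by (auto simp: f_def coeff_pCons split: nat.splits)
  have "degree f = k - i"
  proof (rule antisym)
    show "degree f \<le> k - i" unfolding f_def using assms(4,5)
      by (intro degree_diff_le degree_add_le) (auto intro: order.trans[OF degree_monom_le])
    show "k - i \<le> degree f" using ce \<open>w \<noteq> 0\<close> by (intro le_degree) auto
  qed
  moreover have "coeff f 0 = u" using assms(4,5) by (simp add: f_def)
  moreover have "x ^ i * eval_int_poly x f = of_int u * x ^ i + of_int v * x ^ j - of_int w * x ^ k"
    using assms(4,5) by (simp add: f_def algebra_simps flip: power_add)
  then have "eval_int_poly x f = 0" using assms(6,7) by simp
  ultimately show ?thesis unfolding p_unit_root_def using ce assms(1,3) by (intro exI[of _ f]) auto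
qed

text \<open>The exponent function \<open>k\<close> on pairs plays the role of a valuation of the differences. For a triple
\<open>a, b, c\<close> the relation \<open>(g a - g b) + (g b - g c) = g a - g c\<close> is a trinomial equation for \<open>x\<close>.
If the conclusion fails, the largest exponent of a triple is never attained only once, since
otherwise the trinomial shows that \<open>x\<close> is a \<open>p\<close>-adic unit. So \<open>k\<close> is an ultrametric. It is then
bounded: with \<open>a0\<close> and \<open>a1\<close> fixed, a point \<open>b\<close> with \<open>k {a0, b}\<close> large expresses the integer \<open>u\<close> in
\<open>g a0 - g a1\<close> as a nonzero integer times a large power of \<open>x > 1\<close>. By Ramsey's theorem \<open>k\<close> is
constant on an infinite subset, on which only \<open>p\<close> residues of the integer factors are
available, which is impossible.\<close>

lemma difference_set_yields_p_divisible_power: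
  fixes p :: int and g :: "'a \<Rightarrow> real" and k :: "'a set \<Rightarrow> nat"
  assumes p: "prime p" and x: "x > 1" and inf: "infinite S"
    and diff: "\<And>a b. a \<in> S \<Longrightarrow> b \<in> S \<Longrightarrow> a \<noteq> b \<Longrightarrow>
      \<exists>u. \<not> p dvd u \<and> g a - g b = of_int u * x ^ k {a, b}"
  obtains a b c N U where "a \<in> S" "b \<in> S" "c \<in> S" "a \<noteq> b" "b \<noteq> c" "a \<noteq> c"
    "k {b, c} = k {a, b}" "k {a, b} < k {a, c}"
    "p dvd N" "\<not> p dvd U" "of_int U * x ^ (k {a, c} - k {a, b}) = of_int N"
proof (rule ccontr)
  note result = that
  assume none: "\<not> thesis"
  have not_unit: "\<not> p_unit_root p x"
    using p_unit_root_no_infinite_difference_set[OF p _ inf, of x g] diff by metis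
  have ultrametric: "k {a, c} \<le> max (k {a, b}) (k {b, c})"
    if abc: "a \<in> S" "b \<in> S" "c \<in> S" "a \<noteq> b" "b \<noteq> c" "a \<noteq> c" for a b c
  proof (rule ccontr)
    assume "\<not> k {a, c} \<le> max (k {a, b}) (k {b, c})"
    then have less: "k {a, b} < k {a, c}" "k {b, c} < k {a, c}" by auto
    obtain u where u: "\<not> p dvd u" "g a - g b = of_int u * x ^ k {a, b}" using diff abc by blast
    obtain v where v: "\<not> p dvd v" "g b - g c = of_int v * x ^ k {b, c}" using diff abc by blast
    obtain w where w: "\<not> p dvd w" "g a - g c = of_int w * x ^ k {a, c}" using diff abc by blast
    have eq: "of_int u * x ^ k {a, b} + of_int v * x ^ k {b, c} = of_int w * x ^ k {a, c}"
      using u(2) v(2) w(2) by linarith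
    consider "k {a, b} < k {b, c}" | "k {b, c} < k {a, b}" | "k {b, c} = k {a, b}" by linarith
    then show False
    proof cases
      case 1
      then have "p_unit_root p x"
        using p_unit_root_of_trinomial[OF u(1) v(1) w(1) _ less(2)] eq x by simp
      then show False using not_unit by blast
    next
      case 2
      then have "p_unit_root p x"
        using p_unit_root_of_trinomial[OF v(1) u(1) w(1) _ less(1)] eq x by (simp add: add.commute)
      then show False using not_unit by blast
    next
      case 3
      define e where "e = k {a, c} - k {a, b}"
      have "x ^ k {a, c} = x ^ k {a, b} * x ^ e"
        using less by (simp add: e_def flip: power_add)
      then have "x ^ k {a, b} * (of_int w * x ^ e) = x ^ k {a, b} * of_int (u + v)"
        using eq 3 by (simp add: algebra_simps)
      then have pow: "of_int w * x ^ e = of_int (u + v)" using x by simp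
      show False
      proof (cases "p dvd u + v")
        case True
        then show False
          using none result[OF abc 3 less(1) True w(1)] pow by (simp add: e_def)
      next
        case False
        then show False
          using p_unit_root_of_binomial[OF w(1) False _ pow] less not_unit by (simp add: e_def)
      qed
    qed
  qed
  have "\<exists>a0 a1. a0 \<in> S \<and> a1 \<in> S \<and> a0 \<noteq> a1"
    using inf by (metis finite.emptyI finite_insert finite_subset insert_iff subsetI)
  then obtain a0 a1 where a01: "a0 \<in> S" "a1 \<in> S" "a0 \<noteq> a1" by blast
  obtain u where u: "\<not> p dvd u" "g a0 - g a1 = of_int u * x ^ k {a0, a1}" using diff a01 by blast
  obtain K0 where K0: "\<bar>of_int u\<bar> < x ^ K0" using real_arch_pow[OF x] by blast
  \<comment> \<open>A difference of exponents of at least K0 would make a nonzero multiple of the power exceed u.\<close>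
  define K where "K = k {a0, a1} + K0"
  have bounded: "k {a0, b} \<le> K" if b: "b \<in> S" "b \<noteq> a0" for b
  proof (rule ccontr)
    assume "\<not> k {a0, b} \<le> K"
    then have big: "k {a0, b} > k {a0, a1} + K0" by (simp add: K_def)
    then have b1: "b \<noteq> a1" by auto
    have "k {a0, b} \<le> max (k {a0, a1}) (k {a1, b})" using ultrametric a01 b b1 by simp
    moreover have "k {a1, b} \<le> max (k {a1, a0}) (k {a0, b})" using ultrametric a01 b b1 by simp
    ultimately have keq: "k {a1, b} = k {a0, b}" using big by (simp add: insert_commute max_def split: if_splits)
    obtain v where v: "g a0 - g b = of_int v * x ^ k {a0, b}" using diff a01(1) b by metis
    obtain w where w: "g a1 - g b = of_int w * x ^ k {a1, b}" using diff a01(2) b(1) b1 by metis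
    define e where "e = k {a0, b} - k {a0, a1}"
    have "x ^ k {a0, b} = x ^ k {a0, a1} * x ^ e" using big by (simp add: e_def flip: power_add)
    then have "x ^ k {a0, a1} * of_int u = x ^ k {a0, a1} * (of_int (v - w) * x ^ e)"
      using u(2) v w keq by (simp add: algebra_simps)
    then have ue: "of_int u = of_int (v - w) * x ^ e" using x by simp
    have "u \<noteq> 0" using u(1) by auto
    then have "v - w \<noteq> 0" using ue by auto
    then have "1 \<le> \<bar>of_int (v - w) :: real\<bar>" by linarith
    then have "x ^ e \<le> \<bar>of_int (v - w)\<bar> * x ^ e" using x by simp
    also have "\<dots> = \<bar>of_int u\<bar>" using x by (simp add: ue abs_mult)
    also have "\<dots> < x ^ K0" by (rule K0)
    also have "\<dots> \<le> x ^ e" using x big by (intro power_increasing) (auto simp: e_def)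
    finally show False by simp
  qed
  have "k {a, b} < Suc K" if "a \<in> S" "b \<in> S" "a \<noteq> b" for a b
  proof (cases "a = a0 \<or> b = a0")
    case True
    then show ?thesis using bounded[of a] bounded[of b] that by (metis insert_commute less_Suc_eq_le)
  next
    case False
    have "k {a, b} \<le> max (k {a, a0}) (k {a0, b})"
      by (rule ultrametric) (use that a01 False in auto)
    moreover have "k {a0, a} \<le> K" "k {a0, b} \<le> K" using bounded that False by auto
    ultimately show ?thesis by (simp add: insert_commute)
  qed
  then obtain Y t where Y: "Y \<subseteq> S" "infinite Y"
    and t: "\<And>a b. a \<in> Y \<Longrightarrow> b \<in> Y \<Longrightarrow> a \<noteq> b \<Longrightarrow> k {a, b} = t"
    using Ramsey2[OF inf, of k "Suc K"] by metis
  obtain y where y: "y \<in> Y" using Y(2) by fastforce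
  have "\<exists>u. g a - g y = of_int u * x ^ t" if "a \<in> Y - {y}" for a
    using diff[of a y] t[of a y] that y Y(1) by auto
  then obtain m where m: "\<And>a. a \<in> Y - {y} \<Longrightarrow> g a - g y = of_int (m a) * x ^ t" by metis
  have "(\<lambda>a. m a mod p) ` (Y - {y}) \<subseteq> {0..<p}" using p by (auto simp: prime_gt_0_int)
  then have "finite ((\<lambda>a. m a mod p) ` (Y - {y}))" using finite_subset by blast
  then have "\<not> inj_on (\<lambda>a. m a mod p) (Y - {y})" using Y(2) by (metis finite_imageD infinite_remove)
  then obtain a b where ab: "a \<in> Y - {y}" "b \<in> Y - {y}" "a \<noteq> b" "m a mod p = m b mod p"
    by (auto simp: inj_on_def)
  obtain w where w: "\<not> p dvd w" "g a - g b = of_int w * x ^ t"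
    using diff[of a b] t[of a b] ab Y(1) by auto
  have "g a - g b = of_int (m a - m b) * x ^ t"
    using m[OF ab(1)] m[OF ab(2)] by (simp add: algebra_simps)
  then have "of_int w * x ^ t = of_int (m a - m b) * x ^ t" using w(2) by simp
  then have "w = m a - m b" using x by simp
  then show False using w(1) ab(4) by (simp add: mod_eq_dvd_iff)
qed

lemma power_fraction_lowest_terms:
  fixes p N U :: int
  assumes p: "prime p" and x: "x > 0" and e: "e > 0" and pN: "p dvd N" and pU: "\<not> p dvd U"
    and eq: "of_int U * x ^ e = of_int N"
  obtains s t :: nat where "s \<ge> 1" "t \<ge> 1" "p dvd int t" "gcd s t = 1"
    "x = (real t / real s) powr (1 / real e)"
proof -
  have U0: "U \<noteq> 0" using pU by auto
  have N0: "N \<noteq> 0" using eq U0 x by auto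
  define t where "t = nat (\<bar>N\<bar> div gcd U N)"
  define s where "s = nat (\<bar>U\<bar> div gcd U N)"
  have g0: "gcd U N > 0" using U0 by simp
  have t: "int t * gcd U N = \<bar>N\<bar>" by (simp add: t_def pos_imp_zdiv_nonneg_iff[OF g0])
  have s: "int s * gcd U N = \<bar>U\<bar>" by (simp add: s_def pos_imp_zdiv_nonneg_iff[OF g0])
  have "s \<ge> 1" using s U0 by (cases s) auto
  moreover have "t \<ge> 1" using t N0 by (cases t) auto
  moreover have "gcd s t = 1"
  proof -
    have "gcd (int s) (int t) * gcd U N = gcd (int s * gcd U N) (int t * gcd U N)"
      using gcd_mult_distrib_int[of "gcd U N" "int s" "int t"] g0 by (simp only: abs_of_pos mult.commute)
    also have "\<dots> = 1 * gcd U N" by (simp add: s t)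
    finally have "gcd (int s) (int t) = 1" using g0 by (metis mult_cancel_right less_irrefl)
    then show ?thesis by simp
  qed
  moreover have "x = (real t / real s) powr (1 / real e)"
  proof -
    have "\<bar>of_int U\<bar> * x ^ e = (\<bar>of_int N\<bar> :: real)" using x by (simp add: abs_mult flip: eq)
    then have "of_int (int s * gcd U N) * x ^ e = (of_int (int t * gcd U N) :: real)"
      by (simp only: s t of_int_abs)
    then have "(real s * x ^ e) * of_int (gcd U N) = real t * of_int (gcd U N)"
      by (metis (no_types) mult.commute mult.assoc of_int_mult of_int_of_nat_eq)
    then have "real s * x ^ e = real t" using U0 by simp
    then have "x ^ e = real t / real s" using \<open>s \<ge> 1\<close> by (simp add: eq_divide_eq mult.commute)
    then have "(real t / real s) powr (1 / real e) = (x ^ e) powr (1 / real e)" by simp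
    also have "\<dots> = x" using x e by (simp add: powr_powr flip: powr_realpow)
    finally show ?thesis by simp
  qed
  moreover have "p dvd int t"
  proof -
    have "p dvd int t * gcd U N" using pN by (simp add: t)
    then have "p dvd int t \<or> p dvd gcd U N" using p by (simp only: prime_dvd_mult_iff)
    then show ?thesis using pU gcd_dvd1 dvd_trans by blast
  qed
  ultimately show ?thesis by (intro that)
qed

section \<open>The Fourier transform of a self-affine measure and its zeros\<close>

lemma expo_add_right: "expo \<xi> (x + y) = expo \<xi> x * expo \<xi> y"
  by (simp add: expo_def inner_add_right algebra_simps flip: exp_add)

lemma norm_expo [simp]: "norm (expo \<xi> x) = 1"
proof -
  have "expo \<xi> x = exp (\<i> * of_real (- 2 * pi * (\<xi> \<bullet> x)))" by (simp add: expo_def algebra_simps)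
  then show ?thesis by (simp only: norm_exp_i_times)
qed

lemma expo_0 [simp]: "expo 0 = (\<lambda>_. 1)"
  by (simp add: expo_def fun_eq_iff)

lemma borel_measurable_expo [measurable]: "expo \<xi> \<in> borel_measurable borel"
  unfolding expo_def by (intro borel_measurable_continuous_onI continuous_intros)

lemma expo_mult_cnj: "expo \<xi> x * cnj (expo \<eta> x) = expo (\<xi> - \<eta>) x"
proof -
  have "cnj (expo \<eta> x) = expo (- \<eta>) x" by (simp add: expo_def exp_cnj)
  then show ?thesis by (simp add: expo_def inner_diff_left algebra_simps flip: exp_add)
qed

lemma L2_inner_expo: "L2_inner \<mu> (expo \<xi>) (expo \<eta>) = fourier \<mu> (\<xi> - \<eta>)"
  by (simp add: L2_inner_def fourier_def expo_mult_cnj)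

text \<open>An average of probability measures is the monadic bind with the uniform distribution on the index
set, and an integral over a bind is an iterated integral.\<close>

lemma integral_avg_measure_real:
  fixes f :: "real^2 \<Rightarrow> real"
  assumes E: "finite E" "E \<noteq> {}"
    and \<nu>: "\<And>e. e \<in> E \<Longrightarrow> prob_space (\<nu> e)" "\<And>e. e \<in> E \<Longrightarrow> sets (\<nu> e) = sets borel"
    and f: "f \<in> borel_measurable borel" "\<And>x. \<bar>f x\<bar> \<le> B"
  shows "integrable (avg_measure E \<nu>) f"
    and "integral\<^sup>L (avg_measure E \<nu>) f = (\<Sum>e\<in>E. integral\<^sup>L (\<nu> e) f) / card E"
proof -
  \<comment> \<open>The bind needs a probability measure at every point, so the family is extended by Dirac measures.\<close>
  define N where "N = (\<lambda>e. if e \<in> E then \<nu> e else return borel e)"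
  have pN: "prob_space (N e)" and sN: "sets (N e) = sets borel" for e
    using \<nu> by (auto simp: N_def prob_space_return)
  have N: "N \<in> measurable (measure_pmf (pmf_of_set E)) (subprob_algebra borel)"
    using pN sN by (auto simp: space_subprob_algebra prob_space_imp_subprob_space)
  have eq: "avg_measure E \<nu> = measure_pmf (pmf_of_set E) \<bind> N"
  proof (rule measure_eqI)
    show "sets (avg_measure E \<nu>) = sets (measure_pmf (pmf_of_set E) \<bind> N)"
      using sets_bind[of "measure_pmf (pmf_of_set E)" N borel] sN by simp
    fix A assume "A \<in> sets (avg_measure E \<nu>)"
    then have A: "A \<in> sets borel" by simp
    have "emeasure (measure_pmf (pmf_of_set E) \<bind> N) A = (\<Sum>e\<in>E. emeasure (N e) A) / card E"
      using emeasure_bind[OF _ N A] E by (simp add: nn_integral_pmf_of_set)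
    also have "(\<Sum>e\<in>E. emeasure (N e) A) = (\<Sum>e\<in>E. emeasure (\<nu> e) A)"
      by (intro sum.cong) (auto simp: N_def)
    finally show "emeasure (avg_measure E \<nu>) A = emeasure (measure_pmf (pmf_of_set E) \<bind> N) A"
      using emeasure_avg_measure[of E \<nu> A] \<nu>(2) A by simp
  qed
  have le: "AE e in measure_pmf (pmf_of_set E). emeasure (N e) (space (N e)) \<le> ennreal 1"
    using pN by (auto simp: prob_space.emeasure_space_1)
  show "integrable (avg_measure E \<nu>) f"
    unfolding eq by (rule integrable_bind[OF f(1) f(2) N _ le]) (rule measure_pmf.finite_measure)
  have "integral\<^sup>L (avg_measure E \<nu>) f = (LINT e|measure_pmf (pmf_of_set E). integral\<^sup>L (N e) f)"
    unfolding eq by (rule integral_bind[OF f(1) f(2) N _ le]) (rule measure_pmf.finite_measure)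
  also have "\<dots> = (\<Sum>e\<in>E. integral\<^sup>L (N e) f) / card E"
    using E by (simp add: integral_pmf_of_set)
  also have "(\<Sum>e\<in>E. integral\<^sup>L (N e) f) = (\<Sum>e\<in>E. integral\<^sup>L (\<nu> e) f)"
    by (intro sum.cong) (auto simp: N_def)
  finally show "integral\<^sup>L (avg_measure E \<nu>) f = (\<Sum>e\<in>E. integral\<^sup>L (\<nu> e) f) / card E" .
qed

lemma integrable_expo:
  assumes "prob_space \<nu>" "sets \<nu> = sets borel"
  shows "integrable \<nu> (expo \<xi>)"
proof -
  interpret prob_space \<nu> by fact
  have "expo \<xi> \<in> borel_measurable \<nu>" using assms(2) by (simp cong: measurable_cong_sets)
  then show ?thesis by (intro integrable_const_bound[of _ 1]) auto
qed

lemma fourier_avg_measure: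
  assumes E: "finite E" "E \<noteq> {}"
    and \<nu>: "\<And>e. e \<in> E \<Longrightarrow> prob_space (\<nu> e)" "\<And>e. e \<in> E \<Longrightarrow> sets (\<nu> e) = sets borel"
  shows "fourier (avg_measure E \<nu>) \<xi> = (\<Sum>e\<in>E. fourier (\<nu> e) \<xi>) / of_nat (card E)"
proof -
  have bounds: "\<bar>Re (expo \<xi> x)\<bar> \<le> 1" "\<bar>Im (expo \<xi> x)\<bar> \<le> 1" for x
    using abs_Re_le_cmod[of "expo \<xi> x"] abs_Im_le_cmod[of "expo \<xi> x"] by auto
  have ReM: "(\<lambda>x. Re (expo \<xi> x)) \<in> borel_measurable borel"
    and ImM: "(\<lambda>x. Im (expo \<xi> x)) \<in> borel_measurable borel" by measurable
  note Re = integral_avg_measure_real[OF E \<nu> ReM bounds(1)]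
  note Im = integral_avg_measure_real[OF E \<nu> ImM bounds(2)]
  have int: "integrable (avg_measure E \<nu>) (expo \<xi>)"
  proof -
    have "integrable (avg_measure E \<nu>)
        (\<lambda>x. complex_of_real (Re (expo \<xi> x)) + \<i> * complex_of_real (Im (expo \<xi> x)))"
      using Re(1) Im(1) by (intro Bochner_Integration.integrable_add integrable_mult_right integrable_of_real)
    then show ?thesis by (simp flip: complex_eq)
  qed
  have intE: "integrable (\<nu> e) (expo \<xi>)" if "e \<in> E" for e
    using integrable_expo \<nu> that by blast
  show ?thesis
  proof (rule complex_eqI)
    have "Re (fourier (avg_measure E \<nu>) \<xi>) = (\<Sum>e\<in>E. Re (fourier (\<nu> e) \<xi>)) / card E"
      unfolding fourier_def using Re(2) int intE by (simp flip: integral_Re)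
    then show "Re (fourier (avg_measure E \<nu>) \<xi>) = Re ((\<Sum>e\<in>E. fourier (\<nu> e) \<xi>) / of_nat (card E))"
      by simp
    have "Im (fourier (avg_measure E \<nu>) \<xi>) = (\<Sum>e\<in>E. Im (fourier (\<nu> e) \<xi>)) / card E"
      unfolding fourier_def using Im(2) int intE by (simp flip: integral_Im)
    then show "Im (fourier (avg_measure E \<nu>) \<xi>) = Im ((\<Sum>e\<in>E. fourier (\<nu> e) \<xi>) / of_nat (card E))"
      by simp
  qed
qed

lemma fourier_delta_measure:
  assumes "finite E" "E \<noteq> {}"
  shows "fourier (delta_measure E) \<xi> = (\<Sum>e\<in>E. expo \<xi> e) / of_nat (card E)"
proof -
  have "fourier (return borel e) \<xi> = expo \<xi> e" for e
    unfolding fourier_def by (subst integral_return) auto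
  then show ?thesis
    unfolding delta_measure_def using assms
    by (subst fourier_avg_measure) (auto simp: prob_space_return)
qed

lemma fourier_zero:
  assumes "prob_space \<nu>"
  shows "fourier \<nu> 0 = 1"
  unfolding fourier_def using prob_space.prob_space[OF assms] by simp

lemma tendsto_fourier_zero:
  assumes \<nu>: "prob_space \<nu>" "sets \<nu> = sets borel" and lim: "s \<longlonglongrightarrow> 0"
  shows "(\<lambda>n. fourier \<nu> (s n)) \<longlonglongrightarrow> 1"
proof -
  interpret prob_space \<nu> by fact
  have m: "expo \<xi> \<in> borel_measurable \<nu>" for \<xi> using \<nu>(2) by (simp cong: measurable_cong_sets)
  have "(\<lambda>n. LINT x|\<nu>. expo (s n) x) \<longlonglongrightarrow> (LINT x|\<nu>. expo 0 x)"
  proof (rule integral_dominated_convergence[where w = "\<lambda>_. 1"])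
    have "(\<lambda>n. expo (s n) x) \<longlonglongrightarrow> expo 0 x" for x
      unfolding expo_def by (intro tendsto_intros lim)
    then show "AE x in \<nu>. (\<lambda>n. expo (s n) x) \<longlonglongrightarrow> expo 0 x" by simp
  qed (use m in auto)
  then show ?thesis using fourier_zero[OF \<nu>(1)] by (simp add: fourier_def)
qed

text \<open>For \<open>l = inverse \<rho>\<close> and \<open>\<kappa> = c * \<rho>\<close> this is the \<open>k\<close>-th power of the transpose of the matrix
\<open>M\<close>; for \<open>l = \<rho>\<close> and \<open>- \<kappa>\<close> it is the \<open>k\<close>-th power of the inverse of that transpose.\<close>

definition scaled_shear :: "real \<Rightarrow> real \<Rightarrow> nat \<Rightarrow> real^2 \<Rightarrow> real^2" where
  "scaled_shear l \<kappa> k \<xi> = vector [l ^ k * \<xi> $ 1, l ^ k * (\<xi> $ 2 + real k * \<kappa> * \<xi> $ 1)]"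

lemma scaled_shear_nth [simp]:
  "scaled_shear l \<kappa> k \<xi> $ 1 = l ^ k * \<xi> $ 1"
  "scaled_shear l \<kappa> k \<xi> $ 2 = l ^ k * (\<xi> $ 2 + real k * \<kappa> * \<xi> $ 1)"
  by (simp_all add: scaled_shear_def)

lemma vec2_eq_iff: "(x :: real^2) = y \<longleftrightarrow> x $ 1 = y $ 1 \<and> x $ 2 = y $ 2"
  by (simp add: vec_eq_iff forall_2)

lemma scaled_shear_0 [simp]: "scaled_shear l \<kappa> 0 \<xi> = \<xi>"
  by (simp add: vec2_eq_iff)

lemma scaled_shear_add:
  "scaled_shear l \<kappa> (i + j) \<xi> = scaled_shear l \<kappa> i (scaled_shear l \<kappa> j \<xi>)"
  by (simp add: vec2_eq_iff power_add algebra_simps)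

lemma scaled_shear_diff:
  "scaled_shear l \<kappa> k (\<xi> - \<eta>) = scaled_shear l \<kappa> k \<xi> - scaled_shear l \<kappa> k \<eta>"
  by (simp add: vec2_eq_iff algebra_simps)

lemma scaled_shear_inverse:
  assumes "l \<noteq> 0"
  shows "scaled_shear (inverse l) \<kappa> k (scaled_shear l (- \<kappa>) k \<xi>) = \<xi>"
    and "scaled_shear l (- \<kappa>) k (scaled_shear (inverse l) \<kappa> k \<xi>) = \<xi>"
  using assms by (simp_all add: vec2_eq_iff field_simps)

lemma scaled_shear_tendsto_0:
  assumes "0 < l" "l < 1"
  shows "(\<lambda>n. scaled_shear l \<kappa> n \<xi>) \<longlonglongrightarrow> 0"
proof -
  have l: "(\<lambda>n. l ^ n) \<longlonglongrightarrow> 0" using assms by (intro LIMSEQ_power_zero) auto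
  have nl: "(\<lambda>n. real n * l ^ n) \<longlonglongrightarrow> 0" using assms powser_times_n_limit_0[of l] by simp
  have "(\<lambda>n. scaled_shear l \<kappa> n \<xi> $ i) \<longlonglongrightarrow> 0 $ i" for i
  proof -
    have "(\<lambda>n. l ^ n * \<xi> $ 1) \<longlonglongrightarrow> 0" using tendsto_mult_right[OF l] by simp
    moreover have "(\<lambda>n. l ^ n * \<xi> $ 2 + (real n * l ^ n) * (\<kappa> * \<xi> $ 1)) \<longlonglongrightarrow> 0"
      using tendsto_add[OF tendsto_mult_right[OF l] tendsto_mult_right[OF nl]] by simp
    then have "(\<lambda>n. l ^ n * (\<xi> $ 2 + real n * \<kappa> * \<xi> $ 1)) \<longlonglongrightarrow> 0"
      by (simp add: algebra_simps)
    ultimately show ?thesis using exhaust_2[of i] by auto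
  qed
  then show ?thesis by (intro vec_tendstoI)
qed

lemma inner_matrix_inv_eq_scaled_shear:
  fixes M :: "real^2^2"
  assumes M: "M = vector [vector [inverse \<rho>, c], vector [0, inverse \<rho>]]" and \<rho>: "\<rho> \<noteq> 0"
  shows "\<xi> \<bullet> (matrix_inv M *v y) = scaled_shear \<rho> (- (c * \<rho>)) 1 \<xi> \<bullet> y"
proof -
  define W :: "real^2^2" where "W = vector [vector [\<rho>, - c * \<rho>\<^sup>2], vector [0, \<rho>]]"
  have "M ** W = mat 1" "W ** M = mat 1"
    using \<rho> by (auto simp: M W_def matrix_matrix_mult_def mat_def vec_eq_iff forall_2 sum_2
        power2_eq_square field_simps)
  then have "\<exists>A'. M ** A' = mat 1 \<and> A' ** M = mat 1" by blast
  then have "matrix_inv M ** M = mat 1" unfolding matrix_inv_def by (rule someI2_ex) simp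
  then have "matrix_inv M = W"
    using \<open>M ** W = mat 1\<close> by (metis matrix_mul_assoc matrix_mul_lid matrix_mul_rid)
  then show ?thesis
    by (simp add: W_def matrix_vector_mult_def inner_vec_def sum_2 power2_eq_square algebra_simps)
qed

lemma fourier_self_affine:
  assumes D: "finite D" "D \<noteq> {}" and \<mu>: "is_self_affine_measure M D \<mu>"
    and adj: "\<And>y. \<xi> \<bullet> (matrix_inv M *v y) = \<eta> \<bullet> y"
  shows "fourier \<mu> \<xi> = fourier (delta_measure D) \<eta> * fourier \<mu> \<eta>"
proof -
  have prob: "prob_space \<mu>" and eq: "\<mu> = avg_measure D (\<lambda>d. distr \<mu> borel (affine_map M d))"
    using \<mu> by (auto simp: is_self_affine_measure_def)
  have sets: "sets \<mu> = sets borel" by (subst eq) simp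
  have meas: "affine_map M d \<in> measurable \<mu> borel" for d
  proof -
    have "affine_map M d \<in> borel_measurable borel"
    proof (rule borel_measurable_continuous_onI)
      have "continuous_on UNIV ((*v) (matrix_inv M))"
        by (rule matrix_vector_mult_linear_continuous_on)
      then show "continuous_on UNIV (affine_map M d)"
        unfolding affine_map_def by (rule continuous_on_compose2) (auto intro!: continuous_intros)
    qed
    then show ?thesis using sets by (simp cong: measurable_cong_sets)
  qed
  have step: "fourier (distr \<mu> borel (affine_map M d)) \<xi> = expo \<eta> d * fourier \<mu> \<eta>" for d
  proof -
    have "fourier (distr \<mu> borel (affine_map M d)) \<xi> = (LINT x|\<mu>. expo \<xi> (affine_map M d x))"
      unfolding fourier_def by (rule integral_distr[OF meas]) simp
    also have "\<dots> = (LINT x|\<mu>. expo \<eta> d * expo \<eta> x)"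
    proof -
      have "expo \<xi> (affine_map M d x) = expo \<eta> d * expo \<eta> x" for x
      proof -
        have "expo \<xi> (affine_map M d x) = expo \<eta> (x + d)"
          by (simp add: expo_def affine_map_def adj)
        then show ?thesis by (simp add: expo_add_right mult.commute)
      qed
      then show ?thesis by simp
    qed
    finally show ?thesis by (simp add: fourier_def)
  qed
  have "fourier \<mu> \<xi> = fourier (avg_measure D (\<lambda>d. distr \<mu> borel (affine_map M d))) \<xi>"
    using eq by simp
  also have "\<dots> = (\<Sum>d\<in>D. expo \<eta> d * fourier \<mu> \<eta>) / of_nat (card D)"
    using D prob meas by (subst fourier_avg_measure) (auto simp: step prob_space.prob_space_distr)
  also have "\<dots> = fourier (delta_measure D) \<eta> * fourier \<mu> \<eta>"
    by (simp add: fourier_delta_measure D sum_distrib_right)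
  finally show ?thesis .
qed

text \<open>Iterating the functional equation \<open>n\<close> times leaves as last factor the transform of \<open>\<mu>\<close> at a
point that tends to zero as \<open>n\<close> grows. There the transform is close to 1, so a zero of it can
only come from one of the finitely many factors of the digit set; the infinite product is never formed.\<close>

lemma fourier_self_affine_eq_0_iff:
  assumes \<rho>: "0 < \<rho>" "\<rho> < 1"
    and M: "M = vector [vector [inverse \<rho>, c], vector [0, inverse \<rho>]]"
    and D: "finite D" "D \<noteq> {}" and \<mu>: "is_self_affine_measure M D \<mu>"
  shows "fourier \<mu> \<xi> = 0 \<longleftrightarrow>
    (\<exists>k\<ge>1. \<exists>z. fourier (delta_measure D) z = 0 \<and> \<xi> = scaled_shear (inverse \<rho>) (c * \<rho>) k z)"
proof -
  define R where "R = scaled_shear \<rho> (- (c * \<rho>))"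
  have prob: "prob_space \<mu>" and sets: "sets \<mu> = sets borel"
    using \<mu> unfolding is_self_affine_measure_def by (simp, metis sets_avg_measure)
  have rec: "fourier \<mu> (R n \<xi>) = fourier (delta_measure D) (R (Suc n) \<xi>) * fourier \<mu> (R (Suc n) \<xi>)" for n
  proof -
    have "R (Suc n) \<xi> = R 1 (R n \<xi>)" unfolding R_def by (simp flip: scaled_shear_add)
    then show ?thesis
      using fourier_self_affine[OF D \<mu>, of "R n \<xi>" "R 1 (R n \<xi>)"]
        inner_matrix_inv_eq_scaled_shear[OF M] \<rho> by (simp add: R_def)
  qed
  have R0: "R 0 \<xi> = \<xi>" by (simp add: R_def)
  have "fourier \<mu> \<xi> = 0 \<longleftrightarrow> (\<exists>k\<ge>1. fourier (delta_measure D) (R k \<xi>) = 0)"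
  proof
    assume zero: "fourier \<mu> \<xi> = 0"
    show "\<exists>k\<ge>1. fourier (delta_measure D) (R k \<xi>) = 0"
    proof (rule ccontr)
      assume no: "\<not> ?thesis"
      have "fourier \<mu> (R n \<xi>) = 0" for n
      proof (induction n)
        case 0
        then show ?case using zero R0 by simp
      next
        case (Suc n)
        then show ?case using rec[of n] no by auto
      qed
      moreover have "(\<lambda>n. fourier \<mu> (R n \<xi>)) \<longlonglongrightarrow> 1"
        unfolding R_def by (intro tendsto_fourier_zero prob sets scaled_shear_tendsto_0 \<rho>)
      ultimately show False by (simp add: LIMSEQ_const_iff)
    qed
  next
    assume "\<exists>k\<ge>1. fourier (delta_measure D) (R k \<xi>) = 0"
    then obtain k where k: "k \<ge> 1" "fourier (delta_measure D) (R k \<xi>) = 0" by blast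
    have "fourier \<mu> (R (k - 1) \<xi>) = 0" using rec[of "k - 1"] k by simp
    moreover have "fourier \<mu> (R n \<xi>) = 0 \<Longrightarrow> fourier \<mu> \<xi> = 0" for n
    proof (induction n)
      case 0
      then show ?case using R0 by simp
    next
      case (Suc n)
      then show ?case using rec[of n] by simp
    qed
    ultimately show "fourier \<mu> \<xi> = 0" by blast
  qed
  also have "\<dots> \<longleftrightarrow> (\<exists>k\<ge>1. \<exists>z. fourier (delta_measure D) z = 0 \<and>
      \<xi> = scaled_shear (inverse \<rho>) (c * \<rho>) k z)"
  proof -
    have "R k (scaled_shear (inverse \<rho>) (c * \<rho>) k z) = z"
      "scaled_shear (inverse \<rho>) (c * \<rho>) k (R k z) = z" for k z
      using scaled_shear_inverse[of \<rho> "c * \<rho>"] \<rho> by (simp_all add: R_def)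
    then show ?thesis by metis
  qed
  finally show ?thesis .
qed

section \<open>The zeros of the digit set\<close>

definition fraction_lattice :: "nat \<Rightarrow> real^2 \<Rightarrow> (real^2) set" where
  "fraction_lattice p a = (\<Union>j\<in>{1..p - 1}. {(real j / real p) *\<^sub>R a + z | z. z \<in> integer_lattice})"

lemma mem_integer_lattice_iff: "z \<in> integer_lattice \<longleftrightarrow> z $ 1 \<in> \<int> \<and> z $ 2 \<in> \<int>"
  by (simp add: integer_lattice_def forall_2)

lemma uminus_integer_lattice: "z \<in> integer_lattice \<Longrightarrow> - z \<in> integer_lattice"
  by (simp add: mem_integer_lattice_iff)

text \<open>Allowing every integer \<open>j\<close> prime to \<open>p\<close> in place of \<open>1, ..., p - 1\<close> makes the symmetry under
negation and the closure properties below visible.\<close>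

lemma mem_fraction_lattice_iff:
  assumes p: "p > 0" and a: "a \<in> integer_lattice"
  shows "z \<in> fraction_lattice p a \<longleftrightarrow>
    (\<exists>j::int. \<not> int p dvd j \<and> z - (of_int j / real p) *\<^sub>R a \<in> integer_lattice)"
proof
  assume "z \<in> fraction_lattice p a"
  then obtain j y where j: "j \<in> {1..p - 1}" and y: "y \<in> integer_lattice"
    and z: "z = (real j / real p) *\<^sub>R a + y" by (auto simp: fraction_lattice_def)
  have "\<not> int p dvd int j" using j p by (auto dest!: dvd_imp_le)
  moreover have "z - (of_int (int j) / real p) *\<^sub>R a \<in> integer_lattice" using z y by simp
  ultimately show "\<exists>j::int. \<not> int p dvd j \<and> z - (of_int j / real p) *\<^sub>R a \<in> integer_lattice" by blast
next
  assume "\<exists>j::int. \<not> int p dvd j \<and> z - (of_int j / real p) *\<^sub>R a \<in> integer_lattice"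
  then obtain j where j: "\<not> int p dvd j" "z - (of_int j / real p) *\<^sub>R a \<in> integer_lattice" by blast
  define i where "i = nat (j mod int p)"
  have i: "int i = j mod int p" using p by (simp add: i_def)
  have "i \<noteq> 0"
  proof
    assume "i = 0"
    then have "j mod int p = 0" using i by simp
    then show False using j(1) by (simp add: dvd_eq_mod_eq_0)
  qed
  moreover have "int i < int p" unfolding i using p by simp
  ultimately have "i \<in> {1..p - 1}" by auto
  have "of_int j = (of_int (int i + int p * (j div int p)) :: real)" unfolding i by simp
  then have frac: "of_int j / real p = real i / real p + of_int (j div int p)"
    using p by (simp add: field_simps)
  define y where "y = z - (real i / real p) *\<^sub>R a"
  have "y = (z - (of_int j / real p) *\<^sub>R a) + of_int (j div int p) *\<^sub>R a"
    unfolding frac by (simp add: y_def scaleR_add_left)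
  then have "y \<in> integer_lattice" using j(2) a by (simp add: mem_integer_lattice_iff)
  moreover have "z = (real i / real p) *\<^sub>R a + y" by (simp add: y_def)
  ultimately show "z \<in> fraction_lattice p a" using \<open>i \<in> {1..p - 1}\<close>
    unfolding fraction_lattice_def by blast
qed

lemma uminus_fraction_lattice:
  assumes "p > 0" "a \<in> integer_lattice" "z \<in> fraction_lattice p a"
  shows "- z \<in> fraction_lattice p a"
proof -
  obtain j :: int where j: "\<not> int p dvd j" "z - (of_int j / real p) *\<^sub>R a \<in> integer_lattice"
    using assms mem_fraction_lattice_iff by blast
  have "- z - (of_int (- j) / real p) *\<^sub>R a = - (z - (of_int j / real p) *\<^sub>R a)" by simp
  then have "- z - (of_int (- j) / real p) *\<^sub>R a \<in> integer_lattice"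
    using uminus_integer_lattice[OF j(2)] by simp
  moreover have "\<not> int p dvd - j" using j(1) by simp
  ultimately show ?thesis using assms mem_fraction_lattice_iff by blast
qed

lemma fraction_lattice_coordinates:
  assumes p: "prime p" and a: "a \<in> E_set p" and z: "z \<in> fraction_lattice p a"
  shows "\<exists>u::int. \<not> int p dvd u \<and> real p * z $ 1 = of_int u" and "z $ 2 \<in> \<rat>"
proof -
  have p0: "p > 0" using p prime_gt_0_nat by blast
  obtain i1 i2 where i: "i1 \<in> {1..p - 1}" and a_eq: "a = vector [real i1, real i2]"
    using a by (auto simp: E_set_def)
  have aL: "a \<in> integer_lattice" by (simp add: mem_integer_lattice_iff a_eq)
  obtain j :: int where j: "\<not> int p dvd j" "z - (of_int j / real p) *\<^sub>R a \<in> integer_lattice"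
    using z mem_fraction_lattice_iff[OF p0 aL] by blast
  obtain m n where m: "z $ 1 - of_int j / real p * real i1 = of_int m"
    and n: "z $ 2 - of_int j / real p * real i2 = of_int n"
    using j(2) by (auto simp: mem_integer_lattice_iff a_eq elim!: Ints_cases)
  have "real p * z $ 1 = of_int (j * int i1 + int p * m)" using m p0 by (simp add: field_simps)
  moreover have "\<not> int p dvd j * int i1 + int p * m"
  proof -
    have "\<not> int p dvd int i1" using i by (auto dest!: dvd_imp_le)
    then show ?thesis using j(1) p by (simp add: prime_dvd_mult_iff dvd_add_left_iff)
  qed
  ultimately show "\<exists>u::int. \<not> int p dvd u \<and> real p * z $ 1 = of_int u" by blast
  have "z $ 2 = of_int n + of_int j / real p * real i2" using n by simp
  then show "z $ 2 \<in> \<rat>" by simp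
qed

lemma E_set_subset_integer_lattice: "a \<in> E_set p \<Longrightarrow> a \<in> integer_lattice"
  by (auto simp: E_set_def mem_integer_lattice_iff)

section \<open>Infinite orthogonal sets of exponentials\<close>

text \<open>The first coordinates, multiplied by \<open>p\<close>, form a difference set as above, and it yields three
points \<open>a, b, c\<close> whose exponents are \<open>k, k, k + e\<close> with \<open>l ^ e\<close> a fraction whose numerator only is
divisible by \<open>p\<close>. Cancelling the common linear factor from the sum of the differences gives
\<open>z1 + z2 = scaled_shear l \<kappa> e z3\<close> with rational vectors; its second coordinate is a linear equation
for \<open>\<kappa>\<close> with rational coefficients, and the coefficient of \<open>\<kappa>\<close> does not vanish because \<open>e > 0\<close>
and the first coordinate of \<open>z3\<close> is nonzero.\<close>

lemma infinite_orthogonal_imp_rational_data: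
  fixes a0 :: "real^2"
  assumes p: "prime p" and a0: "a0 \<in> E_set p" and l: "l > 1" and inf: "infinite \<Lambda>"
    and diff: "\<And>\<xi> \<eta>. \<xi> \<in> \<Lambda> \<Longrightarrow> \<eta> \<in> \<Lambda> \<Longrightarrow> \<xi> \<noteq> \<eta> \<Longrightarrow>
      \<exists>k. \<exists>z\<in>fraction_lattice p a0. \<xi> - \<eta> = scaled_shear l \<kappa> k z"
  shows "\<kappa> \<in> \<rat> \<and> (\<exists>s t r. s \<ge> 1 \<and> t \<ge> 1 \<and> r \<ge> 1 \<and> p dvd t \<and> gcd s t = 1 \<and>
    l = (real t / real s) powr (1 / real r))"
proof -
  have p0: "p > 0" using p prime_gt_0_nat by blast
  have a0L: "a0 \<in> integer_lattice" using a0 by (rule E_set_subset_integer_lattice)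
  define P where "P = (\<lambda>\<xi> \<eta> k. \<exists>z\<in>fraction_lattice p a0. \<xi> - \<eta> = scaled_shear l \<kappa> k z)"
  have Psym: "P \<eta> \<xi> k" if Pk: "P \<xi> \<eta> k" for \<xi> \<eta> k
  proof -
    obtain z where z: "z \<in> fraction_lattice p a0" "\<xi> - \<eta> = scaled_shear l \<kappa> k z"
      using Pk by (auto simp: P_def)
    have "\<eta> - \<xi> = - scaled_shear l \<kappa> k z" using z(2) by (metis minus_diff_eq)
    also have "\<dots> = scaled_shear l \<kappa> k (- z)" by (simp add: vec2_eq_iff algebra_simps)
    finally show ?thesis unfolding P_def using uminus_fraction_lattice[OF p0 a0L z(1)] by blast
  qed
  \<comment> \<open>An exponent need not be unique, so one is chosen for each unordered pair.\<close>
  define K where "K = (\<lambda>X. SOME k. \<forall>\<xi> \<eta>. X = {\<xi>, \<eta>} \<longrightarrow> P \<xi> \<eta> k)"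
  have K: "P \<xi> \<eta> (K {\<xi>, \<eta>})" if pair: "\<xi> \<in> \<Lambda>" "\<eta> \<in> \<Lambda>" "\<xi> \<noteq> \<eta>" for \<xi> \<eta>
  proof -
    obtain k where "P \<xi> \<eta> k" using diff[OF pair] by (auto simp: P_def)
    then have "\<forall>\<xi>' \<eta>'. {\<xi>, \<eta>} = {\<xi>', \<eta>'} \<longrightarrow> P \<xi>' \<eta>' k"
      using Psym by (metis doubleton_eq_iff)
    then have "\<forall>\<xi>' \<eta>'. {\<xi>, \<eta>} = {\<xi>', \<eta>'} \<longrightarrow> P \<xi>' \<eta>' (K {\<xi>, \<eta>})"
      unfolding K_def by (rule someI)
    then show ?thesis by blast
  qed
  have first: "\<exists>u. \<not> int p dvd u \<and> real p * \<xi> $ 1 - real p * \<eta> $ 1 = of_int u * l ^ K {\<xi>, \<eta>}"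
    if "\<xi> \<in> \<Lambda>" "\<eta> \<in> \<Lambda>" "\<xi> \<noteq> \<eta>" for \<xi> \<eta>
  proof -
    obtain z where z: "z \<in> fraction_lattice p a0" "\<xi> - \<eta> = scaled_shear l \<kappa> (K {\<xi>, \<eta>}) z"
      using K \<open>\<xi> \<in> \<Lambda>\<close> \<open>\<eta> \<in> \<Lambda>\<close> \<open>\<xi> \<noteq> \<eta>\<close> unfolding P_def by blast
    have "real p * \<xi> $ 1 - real p * \<eta> $ 1 = real p * (\<xi> - \<eta>) $ 1" by (simp add: algebra_simps)
    also have "\<dots> = (real p * z $ 1) * l ^ K {\<xi>, \<eta>}" by (simp add: z(2))
    finally show ?thesis using fraction_lattice_coordinates(1)[OF p a0 z(1)] by metis
  qed
  have l0: "l > 0" using l by simp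
  have p': "prime (int p)" using p by simp
  obtain a b c N U where abc: "a \<in> \<Lambda>" "b \<in> \<Lambda>" "c \<in> \<Lambda>" "a \<noteq> b" "b \<noteq> c" "a \<noteq> c"
    and k: "K {b, c} = K {a, b}" "K {a, b} < K {a, c}"
    and NU: "int p dvd N" "\<not> int p dvd U" "of_int U * l ^ (K {a, c} - K {a, b}) = of_int N"
    using difference_set_yields_p_divisible_power[where g = "\<lambda>\<xi>. real p * \<xi> $ 1", OF p' l inf first]
    by blast
  define e where "e = K {a, c} - K {a, b}"
  have e: "e > 0" "K {a, c} = K {a, b} + e" using k(2) by (auto simp: e_def)
  have pow: "of_int U * l ^ e = of_int N" using NU(3) by (simp add: e_def)
  obtain s t where st: "s \<ge> 1" "t \<ge> 1" "int p dvd int t" "gcd s t = 1"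
    "l = (real t / real s) powr (1 / real e)"
    by (rule power_fraction_lowest_terms[OF p' l0 e(1) NU(1,2) pow])
  have "\<kappa> \<in> \<rat>"
  proof -
    obtain z1 where z1: "z1 \<in> fraction_lattice p a0" "a - b = scaled_shear l \<kappa> (K {a, b}) z1"
      using K abc(1,2,4) unfolding P_def by blast
    obtain z2 where z2: "z2 \<in> fraction_lattice p a0" "b - c = scaled_shear l \<kappa> (K {b, c}) z2"
      using K abc(2,3,5) unfolding P_def by blast
    obtain z3 where z3: "z3 \<in> fraction_lattice p a0" "a - c = scaled_shear l \<kappa> (K {a, c}) z3"
      using K abc(1,3,6) unfolding P_def by blast
    \<comment> \<open>The common factor of the three differences is cancelled by applying the inverse map.\<close>
    define B where "B = scaled_shear (inverse l) (- \<kappa>) (K {a, b})"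
    have inv: "B (scaled_shear l \<kappa> (K {a, b}) z) = z" for z
      using scaled_shear_inverse(1)[of l "- \<kappa>"] l by (simp add: B_def)
    have "B (a - c) - B (b - c) = B (a - b)" by (simp add: B_def flip: scaled_shear_diff)
    then have "scaled_shear l \<kappa> e z3 - z2 = z1"
      by (simp add: z1(2) z2(2) z3(2) k(1) e(2) scaled_shear_add inv)
    then have "(scaled_shear l \<kappa> e z3 - z2) $ 2 = z1 $ 2" by simp
    then have eq: "l ^ e * (z3 $ 2 + real e * \<kappa> * z3 $ 1) = z1 $ 2 + z2 $ 2" by simp
    obtain u where u: "\<not> int p dvd u" "real p * z3 $ 1 = of_int u"
      using fraction_lattice_coordinates(1)[OF p a0 z3(1)] by blast
    have "u \<noteq> 0" using u(1) by auto
    have z31: "z3 $ 1 = of_int u / real p" using u(2) p0 by (simp add: field_simps)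
    have "U \<noteq> 0" using NU(2) by auto
    then have le: "l ^ e = of_int N / of_int U" using pow by (simp add: field_simps)
    have "(z1 $ 2 + z2 $ 2) / l ^ e - z3 $ 2 = \<kappa> * (real e * z3 $ 1)"
      using l by (simp flip: eq)
    moreover have "real e * z3 $ 1 \<noteq> 0" using e(1) z31 \<open>u \<noteq> 0\<close> p0 by simp
    ultimately have "\<kappa> = ((z1 $ 2 + z2 $ 2) / l ^ e - z3 $ 2) / (real e * z3 $ 1)" by simp
    also have "\<dots> \<in> \<rat>"
      unfolding le z31 using fraction_lattice_coordinates(2)[OF p a0] z1(1) z2(1) z3(1)
      by (intro Rats_divide Rats_diff Rats_add Rats_mult) auto
    finally show ?thesis .
  qed
  moreover have "e \<ge> 1" "p dvd t" using e st(3) by auto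
  ultimately show ?thesis
    using st by (intro conjI exI[of _ s] exI[of _ t] exI[of _ e])
qed

text \<open>For a suitable \<open>K\<close> the \<open>K\<close>-th power of the linear map is \<open>T / S\<close> times an integral shear, where
\<open>p\<close> divides \<open>T\<close> but not \<open>S\<close>. The \<open>n\<close>-th frequency is the \<open>n\<close>-th power of this map applied to
\<open>S ^ n\<close> times \<open>a0 / p\<close>. In the difference of two of them the smaller power factors out; what
remains of the later term is an integer vector, since \<open>S\<close> cancels the denominators and \<open>T\<close> cancels
\<open>p\<close>, and the earlier term is a multiple of \<open>a0 / p\<close> by an integer prime to \<open>p\<close>.\<close>

lemma rational_data_imp_infinite_orthogonal:
  fixes a0 :: "real^2"
  assumes p: "prime p" and a0: "a0 \<in> integer_lattice"
    and st: "s \<ge> 1" "p dvd t" "gcd s t = 1" and r: "r \<ge> 1" "l ^ r = real t / real s"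
    and \<kappa>: "\<kappa> \<in> \<rat>"
  shows "\<exists>f :: nat \<Rightarrow> real^2. \<forall>i j. i < j \<longrightarrow>
      (\<exists>k\<ge>1. \<exists>z\<in>fraction_lattice p a0. f j - f i = scaled_shear l \<kappa> k z)"
proof -
  have p0: "p > 0" using p prime_gt_0_nat by blast
  obtain h m :: int where hm: "m > 0" "\<kappa> = of_int h / of_int m"
    using \<kappa> by (auto elim: Rats_cases')
  \<comment> \<open>The factor r makes the power of l rational, the factor m makes the shear integral.\<close>
  define K where "K = r * nat m"
  have K: "K \<ge> 1" using r(1) hm(1) by (simp add: K_def)
  define T where "T = t ^ nat m"
  define S where "S = s ^ nat m"
  have S0: "S > 0" using st(1) by (simp add: S_def)
  have lK: "l ^ K = real T / real S" by (simp add: K_def power_mult r(2) T_def S_def power_divide)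
  have K\<kappa>: "real K * \<kappa> = of_int (int r * h)" using hm by (simp add: K_def)
  have pS: "\<not> int p dvd - int (S ^ n)" for n
  proof
    assume "int p dvd - int (S ^ n)"
    then have "p dvd S ^ n" by (simp only: dvd_minus_iff int_dvd_int_iff)
    then have "p dvd s" using p prime_dvd_power unfolding S_def by blast
    then have "p dvd gcd s t" using st(2) by simp
    then show False using st(3) p by simp
  qed
  have "p dvd T" using st(2) hm(1) by (simp add: T_def dvd_power_le[of p t 1 "nat m", simplified])
  then obtain q where q: "T = p * q" by (auto elim: dvdE)
  \<comment> \<open>The index is shifted because the zeros of the Fourier transform need a positive exponent.\<close>
  define f where "f = (\<lambda>n. scaled_shear l \<kappa> (K * Suc n) ((real (S ^ Suc n) / real p) *\<^sub>R a0))"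
  have "\<exists>k\<ge>1. \<exists>z\<in>fraction_lattice p a0. f j - f i = scaled_shear l \<kappa> k z" if ij: "i < j" for i j
  proof -
    define d where "d = j - i"
    have d: "Suc j = Suc i + d" "d \<ge> 1" using ij by (auto simp: d_def)
    define w where "w = scaled_shear l \<kappa> (K * d) ((real (S ^ Suc j) / real p) *\<^sub>R a0)"
    define z where "z = w - (real (S ^ Suc i) / real p) *\<^sub>R a0"
    have "K * Suc j = K * Suc i + K * d" by (simp add: d(1) algebra_simps)
    then have "f j - f i = scaled_shear l \<kappa> (K * Suc i) z"
      by (simp only: f_def scaled_shear_add scaled_shear_diff z_def w_def)
    moreover have "K * Suc i \<ge> 1" using K by simp
    moreover have "z \<in> fraction_lattice p a0"
    proof -
      have "l ^ (K * d) * (real (S ^ Suc j) / real p) = real (q * T ^ (d - 1) * S ^ Suc i)"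
      proof -
        have "l ^ (K * d) * (real (S ^ Suc j) / real p)
            = (real T ^ d / real S ^ d) * (real S ^ Suc i * real S ^ d / real p)"
          by (simp only: power_mult lK power_divide of_nat_power of_nat_mult d(1) power_add)
        also have "\<dots> = real T ^ d * real S ^ Suc i / real p"
          using S0 by simp
        also have "real T ^ d = real p * real q * real T ^ (d - 1)"
          using d(2) q by (cases d) auto
        finally show ?thesis using p0 by simp
      qed
      then have fac: "l ^ (K * d) * (real (S ^ Suc j) / real p) \<in> \<int>" by (metis Ints_of_nat)
      have "w $ 1 = (l ^ (K * d) * (real (S ^ Suc j) / real p)) * a0 $ 1" by (simp add: w_def)
      moreover have "w $ 2 = (l ^ (K * d) * (real (S ^ Suc j) / real p)) *
          (a0 $ 2 + real d * (real K * \<kappa>) * a0 $ 1)"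
        by (simp add: w_def algebra_simps)
      ultimately have "w \<in> integer_lattice"
        using fac a0 unfolding mem_integer_lattice_iff K\<kappa>
        by (metis Ints_add Ints_mult Ints_of_int Ints_of_nat)
      moreover have "z - (of_int (- int (S ^ Suc i)) / real p) *\<^sub>R a0 = w" by (simp add: z_def)
      ultimately show ?thesis
        using mem_fraction_lattice_iff[OF p0 a0] pS[of "Suc i"] by metis
    qed
    ultimately show ?thesis by blast
  qed
  then have "\<forall>i j. i < j \<longrightarrow>
      (\<exists>k\<ge>1. \<exists>z\<in>fraction_lattice p a0. f j - f i = scaled_shear l \<kappa> k z)" by simp
  then show ?thesis by (rule exI[of _ f])
qed

theorem theorem1p1:
  fixes p :: nat and \<rho> c :: real and M :: "real^2^2" and D :: "(real^2) set"
    and \<mu> :: "(real^2) measure"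
  assumes "prime p" and "0 < \<rho>" and "\<rho> < 1"
    and "M = vector [vector [inverse \<rho>, c], vector [0, inverse \<rho>]]"
    and "D \<subseteq> integer_lattice" and "card D = p"
    and "\<exists>a\<in>E_set p. zero_set (fourier (delta_measure D)) =
           (\<Union>j\<in>{1..p - 1}. {(real j / real p) *\<^sub>R a + z | z. z \<in> integer_lattice})"
    and "is_self_affine_measure M D \<mu>"
  shows "admits_infinite_orthogonal_exponentials \<mu> \<longleftrightarrow>
    (\<exists>(s::nat) (t::nat) (r::nat) \<kappa>::real.
       s \<ge> 1 \<and> t \<ge> 1 \<and> r \<ge> 1 \<and> p dvd t \<and> gcd s t = 1 \<and> \<kappa> \<in> \<rat> \<and>
       inverse \<rho> = (real t / real s) powr (1 / real r) \<and> c = \<kappa> * inverse \<rho>)"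
proof -
  note p = assms(1) and \<rho> = assms(2,3)
  obtain a where a: "a \<in> E_set p" and Z: "zero_set (fourier (delta_measure D)) = fraction_lattice p a"
    using assms(7) by (auto simp: fraction_lattice_def)
  have aL: "a \<in> integer_lattice" using a by (rule E_set_subset_integer_lattice)
  have p0: "p > 0" using p prime_gt_0_nat by blast
  have D: "finite D" "D \<noteq> {}" using assms(6) p0 card.infinite by force+
  have prob: "prob_space \<mu>" using assms(8) by (simp add: is_self_affine_measure_def)
  have zero: "fourier \<mu> \<xi> = 0 \<longleftrightarrow>
      (\<exists>k\<ge>1. \<exists>z\<in>fraction_lattice p a. \<xi> = scaled_shear (inverse \<rho>) (c * \<rho>) k z)" for \<xi>
    unfolding fourier_self_affine_eq_0_iff[OF \<rho> assms(4) D assms(8)] Z[symmetric]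
    by (auto simp: zero_set_def)
  show ?thesis
  proof
    assume "admits_infinite_orthogonal_exponentials \<mu>"
    then obtain \<Lambda> where \<Lambda>: "infinite \<Lambda>"
      "pairwise (\<lambda>x y. L2_inner \<mu> (expo x) (expo y) = 0) \<Lambda>"
      by (auto simp: admits_infinite_orthogonal_exponentials_def)
    have diff: "\<exists>k. \<exists>z\<in>fraction_lattice p a. \<xi> - \<eta> = scaled_shear (inverse \<rho>) (c * \<rho>) k z"
      if "\<xi> \<in> \<Lambda>" "\<eta> \<in> \<Lambda>" "\<xi> \<noteq> \<eta>" for \<xi> \<eta>
    proof -
      have "fourier \<mu> (\<xi> - \<eta>) = 0"
        using pairwiseD[OF \<Lambda>(2) that] by (simp add: L2_inner_expo)
      then show ?thesis using zero by blast
    qed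
    have "c * \<rho> \<in> \<rat> \<and> (\<exists>s t r. s \<ge> 1 \<and> t \<ge> 1 \<and> r \<ge> 1 \<and> p dvd t \<and> gcd s t = 1 \<and>
        inverse \<rho> = (real t / real s) powr (1 / real r))"
      by (rule infinite_orthogonal_imp_rational_data[OF p a one_less_inverse[OF \<rho>] \<Lambda>(1) diff])
    then obtain s t r where "c * \<rho> \<in> \<rat>" "s \<ge> 1" "t \<ge> 1" "r \<ge> 1" "p dvd t" "gcd s t = 1"
        "inverse \<rho> = (real t / real s) powr (1 / real r)" by (elim conjE exE) (rule that)
    moreover have "c = (c * \<rho>) * inverse \<rho>" using \<rho> by simp
    ultimately show "\<exists>(s::nat) (t::nat) (r::nat) \<kappa>::real.
       s \<ge> 1 \<and> t \<ge> 1 \<and> r \<ge> 1 \<and> p dvd t \<and> gcd s t = 1 \<and> \<kappa> \<in> \<rat> \<and>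
       inverse \<rho> = (real t / real s) powr (1 / real r) \<and> c = \<kappa> * inverse \<rho>" 
      by (intro exI[of _ s] exI[of _ t] exI[of _ r] exI[of _ "c * \<rho>"] conjI)
  next
    assume "\<exists>(s::nat) (t::nat) (r::nat) \<kappa>::real.
       s \<ge> 1 \<and> t \<ge> 1 \<and> r \<ge> 1 \<and> p dvd t \<and> gcd s t = 1 \<and> \<kappa> \<in> \<rat> \<and>
       inverse \<rho> = (real t / real s) powr (1 / real r) \<and> c = \<kappa> * inverse \<rho>"
    then obtain s t r :: nat and \<kappa> :: real where st: "s \<ge> 1" "t \<ge> 1" "p dvd t" "gcd s t = 1"
      and r: "r \<ge> 1" "inverse \<rho> = (real t / real s) powr (1 / real r)"
      and \<kappa>: "\<kappa> \<in> \<rat>" "c = \<kappa> * inverse \<rho>" by (elim exE conjE) (rule that)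
    have "c * \<rho> = \<kappa>" using \<rho> by (simp add: \<kappa>(2) mult.assoc)
    then have c\<rho>: "c * \<rho> \<in> \<rat>" using \<kappa>(1) by simp
    have pos: "real t / real s > 0" using st by simp
    have "inverse \<rho> ^ r = ((real t / real s) powr (1 / real r)) powr real r"
      unfolding r(2) using st(1,2) by (intro powr_realpow[symmetric]) simp
    also have "\<dots> = real t / real s" using pos r(1) by (simp add: powr_powr)
    finally have lr: "inverse \<rho> ^ r = real t / real s" .
    obtain f :: "nat \<Rightarrow> real^2" where diff: "\<forall>i j. i < j \<longrightarrow>
        (\<exists>k\<ge>1. \<exists>z\<in>fraction_lattice p a. f j - f i = scaled_shear (inverse \<rho>) (c * \<rho>) k z)"
      using rational_data_imp_infinite_orthogonal[OF p aL st(1,3,4) r(1) lr c\<rho>] by blast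
    have f: "fourier \<mu> (f j - f i) = 0" if "i < j" for i j :: nat
      unfolding zero by (rule diff[rule_format, OF that])
    have "inj f"
    proof (rule linorder_injI)
      fix i j :: nat assume "i < j"
      then show "f i \<noteq> f j" using f[of i j] fourier_zero[OF prob] by auto
    qed
    then have "infinite (range f)" using finite_imageD by blast
    moreover have "pairwise (\<lambda>x y. L2_inner \<mu> (expo x) (expo y) = 0) (range f)"
    proof (rule pairwiseI)
      fix x y assume "x \<in> range f" "y \<in> range f" "x \<noteq> y"
      then obtain i j where ij: "x = f i" "y = f j" "i \<noteq> j" by auto
      have sym: "L2_inner \<mu> (expo x) (expo y) = cnj (L2_inner \<mu> (expo y) (expo x))"
        by (simp add: L2_inner_def mult.commute flip: Bochner_Integration.integral_cnj)
      show "L2_inner \<mu> (expo x) (expo y) = 0"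
        using f ij sym by (cases "i < j") (auto simp: L2_inner_expo)
    qed
    ultimately show "admits_infinite_orthogonal_exponentials \<mu>"
      unfolding admits_infinite_orthogonal_exponentials_def by blast
  qed
qed

end
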